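(* Let $(X_n)_{n\in\mathbb{T}}$ be a (possibly time-inhomogeneous, non-stationary) Markov chain on a finite state space $\mathbb{S}$ with transition probabilities $P_{ij}(n)=\mathbb{P}(X_{n+1}=j\mid X_n=i)$ and committors $q^+(n)$, $q^-(n)$. Then for all $n$ with $n,n+1\in\mathbb{T}$ and all $i,j\in\mathbb{S}$ the current of reactive trajectories is given by $$f^{AB}_{ij}(n)=q_i^-(n)\,\mathbb{P}(X_n=i)\,P_{ij}(n)\,q_j^+(n+1).$$
   Context: $A,B\subset\mathbb{S}$ are non-empty disjoint subsets of the finite state space $\mathbb{S}$ with $C:=(A\cup B)^c$ non-empty. The time set is $\mathbb{T}=\mathbb{Z}$ or $\mathbb{T}=\{0,1,\dots,N-1\}$. For $S\subset\mathbb{S}$ and $n\in\mathbb{T}$: $\tau_S^+(n):=\inf\{k\in\mathbb{T}: k\ge n, X_k\in S\}$ ($\inf\emptyset:=\infty$), $\tau_S^-(n):=\sup\{k\in\mathbb{T}: k\le n, X_k\in S\}$ ($\sup\emptyset:=-\infty$). The committors are $q_i^+(n):=\mathbb{P}(\tau_B^+(n)<\tau_A^+(n)\mid X_n=i)$ and $q_i^-(n):=\mathbb{P}(\tau_A^-(n)>\tau_B^-(n)\mid X_n=i)$. The current of reactive trajectories is $f^{AB}_{ij}(n):=\mathbb{P}(X_n=i,\ X_{n+1}=j,\ \tau_A^-(n)>\tau_B^-(n),\ \tau_B^+(n+1)<\tau_A^+(n+1))$. Committors at (time, state) pairs of probability zero may be given arbitrary values in $[0,1]$; a product containing a zero factor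 is $0$. *)

theory Defs
  imports "HOL-Probability.Probability"
begin

text \<open>Both kinds of time set live inside \<open>int\<close>; \<open>X n\<close> is only constrained for \<open>n \<in> T\<close>.\<close>

definition time_set :: "int set \<Rightarrow> bool" where
  "time_set T \<longleftrightarrow> T = UNIV \<or> (\<exists>N::nat. T = {0..<int N})"

text \<open>
  The Markov property is stated by conditioning on finite histories of positive probability,
  which for \<open>T = UNIV\<close> have no first time point. The chain may be time-inhomogeneous and
  non-stationary. The state space is the finite type \<open>'s\<close>.
\<close>

locale markov_chain = prob_space M
  for M :: "'w measure" +
  fixes T :: "int set" and X :: "int \<Rightarrow> 'w \<Rightarrow> 's::finite"
  assumes time: "time_set T"
    and random_variable_X: "n \<in> T \<Longrightarrow> X n \<in> M \<rightarrow>\<^sub>M count_space UNIV"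
    and markov_property:
      "m \<in> T \<Longrightarrow> n + 1 \<in> T \<Longrightarrow> m \<le> n \<Longrightarrow>
       \<P>(w in M. \<forall>k\<in>{m..n}. X k w = x k) > 0 \<Longrightarrow>
       \<P>(w in M. X (n + 1) w = j \<bar> \<forall>k\<in>{m..n}. X k w = x k) =
       \<P>(w in M. X (n + 1) w = j \<bar> X n w = x n)"

text \<open>The infimum and supremum are taken in \<open>ereal\<close>, where \<open>Inf {} = \<infinity>\<close> and \<open>Sup {} = -\<infinity>\<close>.\<close>

definition first_entrance :: "int set \<Rightarrow> (int \<Rightarrow> 'w \<Rightarrow> 's) \<Rightarrow> 's set \<Rightarrow> int \<Rightarrow> 'w \<Rightarrow> ereal" where
  "first_entrance T X S n w = (INF k\<in>{k \<in> T. k \<ge> n \<and> X k w \<in> S}. ereal (real_of_int k))"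

definition last_exit :: "int set \<Rightarrow> (int \<Rightarrow> 'w \<Rightarrow> 's) \<Rightarrow> 's set \<Rightarrow> int \<Rightarrow> 'w \<Rightarrow> ereal" where
  "last_exit T X S n w = (SUP k\<in>{k \<in> T. k \<le> n \<and> X k w \<in> S}. ereal (real_of_int k))"

text \<open>
  Conditional probabilities given \<open>X n = i\<close> are determined only where \<open>X n = i\<close> has positive
  probability. At the remaining pairs, the transition probabilities are left unconstrained and
  the committors may take arbitrary values in \<open>[0,1]\<close>. So \<open>P\<close>, \<open>qp\<close> and \<open>qm\<close> below are
  versions of the respective conditional probabilities.
\<close>

definition transition_probabilities ::
    "'w measure \<Rightarrow> int set \<Rightarrow> (int \<Rightarrow> 'w \<Rightarrow> 's) \<Rightarrow> (int \<Rightarrow> 's \<Rightarrow> 's \<Rightarrow> real) \<Rightarrow> bool" where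
  "transition_probabilities M T X P \<longleftrightarrow>
    (\<forall>n i j. n \<in> T \<longrightarrow> n + 1 \<in> T \<longrightarrow> \<P>(w in M. X n w = i) > 0 \<longrightarrow>
      P n i j = \<P>(w in M. X (n + 1) w = j \<bar> X n w = i))"

definition forward_committor ::
    "'w measure \<Rightarrow> int set \<Rightarrow> (int \<Rightarrow> 'w \<Rightarrow> 's) \<Rightarrow> 's set \<Rightarrow> 's set \<Rightarrow> (int \<Rightarrow> 's \<Rightarrow> real) \<Rightarrow> bool" where
  "forward_committor M T X A B qp \<longleftrightarrow>
    (\<forall>n\<in>T. \<forall>i. qp n i \<in> {0..1} \<and>
      (\<P>(w in M. X n w = i) > 0 \<longrightarrow>
        qp n i = \<P>(w in M. first_entrance T X B n w < first_entrance T X A n w \<bar> X n w = i)))"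

definition backward_committor ::
    "'w measure \<Rightarrow> int set \<Rightarrow> (int \<Rightarrow> 'w \<Rightarrow> 's) \<Rightarrow> 's set \<Rightarrow> 's set \<Rightarrow> (int \<Rightarrow> 's \<Rightarrow> real) \<Rightarrow> bool" where
  "backward_committor M T X A B qm \<longleftrightarrow>
    (\<forall>n\<in>T. \<forall>i. qm n i \<in> {0..1} \<and>
      (\<P>(w in M. X n w = i) > 0 \<longrightarrow>
        qm n i = \<P>(w in M. last_exit T X A n w > last_exit T X B n w \<bar> X n w = i)))"

definition reactive_current ::
    "'w measure \<Rightarrow> int set \<Rightarrow> (int \<Rightarrow> 'w \<Rightarrow> 's) \<Rightarrow> 's set \<Rightarrow> 's set \<Rightarrow> int \<Rightarrow> 's \<Rightarrow> 's \<Rightarrow> real" where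
  "reactive_current M T X A B n i j =
    \<P>(w in M. X n w = i \<and> X (n + 1) w = j \<and>
      last_exit T X A n w > last_exit T X B n w \<and>
      first_entrance T X B (n + 1) w < first_entrance T X A (n + 1) w)"

end

theory Submission imports Defs begin

text \<open>
  Given the present state, the past and the future of a Markov chain are independent. The event
  \<open>\<tau>\<^sub>A\<^sup>-(n) > \<tau>\<^sub>B\<^sup>-(n)\<close> belongs to the past of \<open>n\<close>, and \<open>\<tau>\<^sub>B\<^sup>+(n + 1) < \<tau>\<^sub>A\<^sup>+(n + 1)\<close> to the future of
  \<open>n + 1\<close>. Splitting the reactive event at the present \<open>n\<close> separates the backward
  committor from the step to \<open>j\<close> and everything after it; splitting once more at \<open>n + 1\<close> separates
  the step from the forward committor.

  The conditional independence has to hold for events that depend on infinitely many time points,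
  while the Markov property speaks of finite histories. Finite histories are cylinders, and the
  cylinders over the time windows ending (or starting) at \<open>n\<close> form a \<open>\<pi>\<close>-system that
  generates the past (or future) \<open>\<sigma>\<close>-algebra. So the factorisation of the probabilities of
  cylinders (\<open>cylinder_factorisation\<close>) extends by Dynkin's theorem to these
  \<open>\<sigma>\<close>-algebras (\<open>past_future_factorisation\<close>), with respect to which entrance and exit times
  are measurable as countable infima and suprema.
\<close>

section \<open>Cylinders\<close>

definition cylinder :: "'w measure \<Rightarrow> (int \<Rightarrow> 'w \<Rightarrow> 's) \<Rightarrow> int set \<Rightarrow> (int \<Rightarrow> 's) \<Rightarrow> 'w set" where
  "cylinder M X I x = {w \<in> space M. \<forall>k\<in>I. X k w = x k}"

text \<open>The empty set is included because it arises as the intersection of two cylinders with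
  conflicting prescriptions.\<close>

definition cylinders :: "'w measure \<Rightarrow> (int \<Rightarrow> 'w \<Rightarrow> 's) \<Rightarrow> int set set \<Rightarrow> 'w set set" where
  "cylinders M X \<I> = insert {} {cylinder M X I x | I x. I \<in> \<I>}"

lemma cylinders_subset: "cylinders M X \<I> \<subseteq> Pow (space M)"
  by (auto simp: cylinders_def cylinder_def)

lemma cylinder_cong:
  "(\<And>k. k \<in> I \<Longrightarrow> x k = y k) \<Longrightarrow> cylinder M X I x = cylinder M X I y"
  by (auto simp: cylinder_def)

lemma cylinder_Int:
  assumes "\<And>k. k \<in> I \<inter> J \<Longrightarrow> x k = y k"
  shows "cylinder M X I x \<inter> cylinder M X J y = cylinder M X (I \<union> J) (\<lambda>k. if k \<in> I then x k else y k)"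
proof (intro set_eqI iffI)
  fix w assume w: "w \<in> cylinder M X (I \<union> J) (\<lambda>k. if k \<in> I then x k else y k)"
  have "X k w = y k" if "k \<in> J" for k
    using w that assms[of k] by (cases "k \<in> I") (auto simp: cylinder_def)
  then show "w \<in> cylinder M X I x \<inter> cylinder M X J y"
    using w by (auto simp: cylinder_def)
qed (auto simp: cylinder_def)

lemma cylinder_Int_conflict:
  assumes "k \<in> I" "k \<in> J" "x k \<noteq> y k"
  shows "cylinder M X I x \<inter> cylinder M X J y = {}"
  using assms by (auto simp: cylinder_def)

text \<open>Time windows with a common endpoint form a chain under inclusion, so two compatible cylinders
  over such windows meet in a cylinder over the larger one.\<close>

lemma Int_stable_cylinders:
  assumes chain: "\<And>I J. I \<in> \<I> \<Longrightarrow> J \<in> \<I> \<Longrightarrow> I \<subseteq> J \<or> J \<subseteq> I"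
  shows "Int_stable (cylinders M X \<I>)"
proof (rule Int_stableI)
  fix a b assume ab: "a \<in> cylinders M X \<I>" "b \<in> cylinders M X \<I>"
  show "a \<inter> b \<in> cylinders M X \<I>"
  proof (cases "a = {} \<or> b = {}")
    case True
    then show ?thesis by (auto simp: cylinders_def)
  next
    case False
    with ab obtain I x J y where
      a: "a = cylinder M X I x" "I \<in> \<I>" and b: "b = cylinder M X J y" "J \<in> \<I>"
      by (auto simp: cylinders_def)
    have un: "I \<union> J \<in> \<I>"
      using chain[OF a(2) b(2)] a(2) b(2) by (auto simp: Un_absorb1 Un_absorb2)
    show ?thesis
    proof (cases "\<forall>k\<in>I \<inter> J. x k = y k")
      case True
      then show ?thesis
        using cylinder_Int[of I J x y M X] un unfolding a(1) b(1) cylinders_def by blast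
    next
      case False
      then show ?thesis
        using cylinder_Int_conflict[of _ I J x y M X] unfolding a(1) b(1) cylinders_def by blast
    qed
  qed
qed

text \<open>Prescribing the state at a single time \<open>k\<close> leaves the other times of a finite window free,
  so over a finite state space the event is a finite union of cylinders over that window.\<close>

lemma measurable_sigma_cylinders:
  fixes X :: "int \<Rightarrow> 'w \<Rightarrow> 's::finite"
  assumes I: "I \<in> \<I>" "finite I" "k \<in> I"
  shows "X k \<in> sigma (space M) (cylinders M X \<I>) \<rightarrow>\<^sub>M count_space UNIV"
proof (rule measurableI)
  fix S :: "'s set"
  let ?F = "{x \<in> I \<rightarrow>\<^sub>E UNIV. x k \<in> S}"
  have "X k -` S \<inter> space M = (\<Union>x\<in>?F. cylinder M X I x)"
  proof (intro set_eqI iffI)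
    fix w assume w: "w \<in> X k -` S \<inter> space M"
    show "w \<in> (\<Union>x\<in>?F. cylinder M X I x)"
      by (rule UN_I[of "restrict (\<lambda>l. X l w) I"]) (use w I in \<open>auto simp: cylinder_def\<close>)
  qed (use I in \<open>auto simp: cylinder_def\<close>)
  also have "\<dots> \<in> sigma_sets (space M) (cylinders M X \<I>)"
  proof -
    interpret sigma_algebra "space M" "sigma_sets (space M) (cylinders M X \<I>)"
      by (rule sigma_algebra_sigma_sets[OF cylinders_subset])
    have "finite (I \<rightarrow>\<^sub>E (UNIV :: 's set))" using I by (intro finite_PiE) auto
    then have "finite ?F" by (rule rev_finite_subset) auto
    then show ?thesis
      using I by (intro finite_UN) (auto simp: cylinders_def)
  qed
  finally show "X k -` S \<inter> space (sigma (space M) (cylinders M X \<I>)) \<in> sets (sigma (space M) (cylinders M X \<I>))"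
    using cylinders_subset[of M X \<I>] by simp
qed simp

section \<open>Past and future\<close>

definition past :: "'w measure \<Rightarrow> int set \<Rightarrow> (int \<Rightarrow> 'w \<Rightarrow> 's) \<Rightarrow> int \<Rightarrow> 'w measure" where
  "past M T X n = sigma (space M) (cylinders M X {{m..n} | m. m \<in> T \<and> m \<le> n})"

definition future :: "'w measure \<Rightarrow> int set \<Rightarrow> (int \<Rightarrow> 'w \<Rightarrow> 's) \<Rightarrow> int \<Rightarrow> 'w measure" where
  "future M T X n = sigma (space M) (cylinders M X {{n..k} | k. k \<in> T \<and> n \<le> k})"

lemma space_past [simp]: "space (past M T X n) = space M"
  and space_future [simp]: "space (future M T X n) = space M"
  by (simp_all add: past_def future_def cylinders_subset)

lemma measurable_past:
  fixes X :: "int \<Rightarrow> 'w \<Rightarrow> 's::finite"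
  assumes "k \<in> T" "k \<le> n"
  shows "X k \<in> past M T X n \<rightarrow>\<^sub>M count_space UNIV"
  unfolding past_def by (rule measurable_sigma_cylinders[of "{k..n}"]) (use assms in auto)

lemma measurable_future:
  fixes X :: "int \<Rightarrow> 'w \<Rightarrow> 's::finite"
  assumes "k \<in> T" "n \<le> k"
  shows "X k \<in> future M T X n \<rightarrow>\<^sub>M count_space UNIV"
  unfolding future_def by (rule measurable_sigma_cylinders[of "{n..k}"]) (use assms in auto)

text \<open>The index set of the infimum depends on the outcome. Giving the times outside \<open>S\<close> the
  neutral value \<open>\<infinity>\<close> (for suprema, \<open>-\<infinity>\<close>) makes it a fixed countable set.\<close>

lemma measurable_first_entrance:
  assumes X: "\<And>k. k \<in> T \<Longrightarrow> n \<le> k \<Longrightarrow> X k \<in> N \<rightarrow>\<^sub>M count_space UNIV"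
  shows "first_entrance T X S n \<in> borel_measurable N"
proof -
  let ?f = "\<lambda>k w. if X k w \<in> S then ereal (real_of_int k) else \<infinity>"
  have "first_entrance T X S n = (\<lambda>w. INF k\<in>{k \<in> T. n \<le> k}. ?f k w)"
  proof
    fix w show "first_entrance T X S n w = (INF k\<in>{k \<in> T. n \<le> k}. ?f k w)"
      unfolding first_entrance_def
      by (intro antisym INF_greatest) (auto intro: INF_lower2 Inf_lower)
  qed
  moreover have "?f k \<in> borel_measurable N" if "k \<in> {k \<in> T. n \<le> k}" for k
    using that by (intro measurable_If measurable_const measurable_compose[OF X]) auto
  ultimately show ?thesis by (simp only:) (intro borel_measurable_INF; simp)
qed

lemma measurable_last_exit:
  assumes X: "\<And>k. k \<in> T \<Longrightarrow> k \<le> n \<Longrightarrow> X k \<in> N \<rightarrow>\<^sub>M count_space UNIV"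
  shows "last_exit T X S n \<in> borel_measurable N"
proof -
  let ?f = "\<lambda>k w. if X k w \<in> S then ereal (real_of_int k) else -\<infinity>"
  have "last_exit T X S n = (\<lambda>w. SUP k\<in>{k \<in> T. k \<le> n}. ?f k w)"
  proof
    fix w show "last_exit T X S n w = (SUP k\<in>{k \<in> T. k \<le> n}. ?f k w)"
      unfolding last_exit_def
      by (intro antisym SUP_least) (auto intro: SUP_upper2 Sup_upper)
  qed
  moreover have "?f k \<in> borel_measurable N" if "k \<in> {k \<in> T. k \<le> n}" for k
    using that by (intro measurable_If measurable_const measurable_compose[OF X]) auto
  ultimately show ?thesis by (simp only:) (intro borel_measurable_SUP; simp)
qed

section \<open>Conditional independence of past and future\<close>

context markov_chain
begin

lemma interval_subset_time: "m \<in> T \<Longrightarrow> n \<in> T \<Longrightarrow> {m..n} \<subseteq> T"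
  using time by (auto simp: time_set_def)

lemma events_cylinder:
  assumes "m \<in> T" "n \<in> T"
  shows "cylinder M X {m..n} x \<in> events"
proof -
  have "Measurable.pred M (\<lambda>w. X k w = x k)" if "k \<in> {m..n}" for k
    using interval_subset_time[OF assms] that
    by (intro measurable_compose[OF random_variable_X]) auto
  then show ?thesis unfolding cylinder_def
    by (intro predE pred_intros_finite) auto
qed

lemma prob_cylinder_antimono:
  assumes "m \<in> T" "n \<in> T" "{m..n} \<subseteq> J"
  shows "prob (cylinder M X J x) \<le> prob (cylinder M X {m..n} x)"
  using assms(3) by (intro finite_measure_mono events_cylinder assms(1,2)) (auto simp: cylinder_def)

text \<open>The Markov property with the denominators cleared. In this form it also holds for histories
  of probability zero.\<close>

lemma markov_step:
  assumes mn: "m \<in> T" "n \<in> T" "n + 1 \<in> T" "m \<le> n"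
  shows "prob (cylinder M X {m..n + 1} x) * prob (cylinder M X {n..n} x) =
    prob (cylinder M X {m..n} x) * prob (cylinder M X {n..n + 1} x)"
proof (cases "prob (cylinder M X {m..n} x) > 0")
  case False
  then have "prob (cylinder M X {m..n} x) = 0" using measure_nonneg[of M] by (simp add: not_less antisym)
  moreover have "prob (cylinder M X {m..n + 1} x) \<le> prob (cylinder M X {m..n} x)"
    using mn by (intro prob_cylinder_antimono) auto
  ultimately show ?thesis using measure_nonneg[of M "cylinder M X {m..n + 1} x"] by simp
next
  case True
  have "prob (cylinder M X {m..n} x) \<le> prob (cylinder M X {n..n} x)"
    using mn by (intro prob_cylinder_antimono) auto
  with True have pos: "prob (cylinder M X {n..n} x) > 0" by linarith
  have win: "{m..n + 1} = insert (n + 1) {m..n}" "{n..n + 1} = insert (n + 1) {n}"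
    using mn by auto
  have ev: "{w \<in> space M. X (n + 1) w = x (n + 1) \<and> (\<forall>k\<in>{m..n}. X k w = x k)} = cylinder M X {m..n + 1} x"
    "{w \<in> space M. X (n + 1) w = x (n + 1) \<and> X n w = x n} = cylinder M X {n..n + 1} x"
    "{w \<in> space M. \<forall>k\<in>{m..n}. X k w = x k} = cylinder M X {m..n} x"
    "{w \<in> space M. X n w = x n} = cylinder M X {n..n} x"
    by (auto simp: cylinder_def win)
  have "prob (cylinder M X {m..n + 1} x) / prob (cylinder M X {m..n} x) =
    prob (cylinder M X {n..n + 1} x) / prob (cylinder M X {n..n} x)"
    using markov_property[of m n x "x (n + 1)"] True mn unfolding cond_prob_def ev by simp
  with True pos show ?thesis by (simp add: field_simps)
qed

text \<open>By induction over the length of the future: each step multiplies the probabilities of the long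
  window \<open>{m..k}\<close> and of the future window \<open>{n..k}\<close> by the same transition probability, because
  that depends only on the state at \<open>k\<close>.\<close>

lemma cylinder_factorisation:
  assumes m: "m \<in> T" "m \<le> n" and n: "n \<in> T" and k: "n \<le> k" "k \<in> T"
  shows "prob (cylinder M X {m..k} x) * prob (cylinder M X {n..n} x) =
    prob (cylinder M X {m..n} x) * prob (cylinder M X {n..k} x)"
  using k
proof (induction k rule: int_ge_induct)
  case base
  then show ?case by simp
next
  case (step k)
  let ?p = "\<lambda>a b. prob (cylinder M X {a..b} x)"
  have k: "k \<in> T" using interval_subset_time[OF n step.prems] step.hyps by auto
  have s1: "?p m (k + 1) * ?p k k = ?p m k * ?p k (k + 1)"
    and s2: "?p n (k + 1) * ?p k k = ?p n k * ?p k (k + 1)"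
    using m n k step.hyps step.prems by (intro markov_step; simp)+
  show ?case
  proof (cases "?p k k = 0")
    case True
    have "?p m (k + 1) \<le> ?p k k" "?p n (k + 1) \<le> ?p k k"
      using m k step.hyps by (intro prob_cylinder_antimono; simp)+
    then have "?p m (k + 1) = 0" "?p n (k + 1) = 0"
      using True by (auto intro!: antisym measure_nonneg)
    then show ?thesis by simp
  next
    case False
    have "(?p m (k + 1) * ?p n n) * ?p k k = (?p m k * ?p n n) * ?p k (k + 1)"
      using s1 by algebra
    also have "\<dots> = (?p m n * ?p n k) * ?p k (k + 1)"
      using step.IH[OF k] by simp
    also have "\<dots> = (?p m n * ?p n (k + 1)) * ?p k k"
      using s2 by algebra
    finally show ?thesis using False by simp
  qed
qed

lemma cylinders_past_events: "n \<in> T \<Longrightarrow> cylinders M X {{m..n} | m. m \<in> T \<and> m \<le> n} \<subseteq> events"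
  and cylinders_future_events: "n \<in> T \<Longrightarrow> cylinders M X {{n..k} | k. k \<in> T \<and> n \<le> k} \<subseteq> events"
  using events_cylinder by (auto simp: cylinders_def)

lemma sets_past: "n \<in> T \<Longrightarrow> sets (past M T X n) \<subseteq> events"
  and sets_future: "n \<in> T \<Longrightarrow> sets (future M T X n) \<subseteq> events"
  unfolding past_def future_def
  by (simp_all add: cylinders_subset sets.sigma_sets_subset cylinders_past_events cylinders_future_events)

text \<open>Conditioning on \<open>X n = i\<close> turns \<open>cylinder_factorisation\<close> into independence of two
  \<open>\<pi>\<close>-systems under the conditional measure, so Dynkin's theorem applies. Clearing the
  denominators afterwards includes the states \<open>i\<close> of probability zero.\<close>

lemma past_future_factorisation:
  fixes i :: 's
  assumes n: "n \<in> T" and a: "a \<in> sets (past M T X n)" and b: "b \<in> sets (future M T X n)"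
  defines "s \<equiv> {w \<in> space M. X n w = i}"
  shows "prob (s \<inter> (a \<inter> b)) * prob s = prob (s \<inter> a) * prob (s \<inter> b)"
proof -
  have s: "s = cylinder M X {n..n} (\<lambda>_. i)" by (auto simp: s_def cylinder_def)
  have s_ev: "s \<in> events" unfolding s using n n by (rule events_cylinder)
  show ?thesis
  proof (cases "prob s = 0")
    case True
    have "prob (s \<inter> a) \<le> prob s" using s_ev by (intro finite_measure_mono) auto
    with True have "prob (s \<inter> a) = 0" by (auto intro!: antisym measure_nonneg)
    with True show ?thesis by simp
  next
    case False
    let ?N = "uniform_measure M s"
    let ?A = "cylinders M X {{m..n} | m. m \<in> T \<and> m \<le> n}"
    let ?B = "cylinders M X {{n..k} | k. k \<in> T \<and> n \<le> k}"
    have pos: "emeasure M s \<noteq> 0" "emeasure M s \<noteq> \<infinity>"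
      using False by (auto simp: emeasure_eq_measure)
    interpret N: prob_space ?N by (rule prob_space_uniform_measure[OF pos])
    have N: "measure ?N e = prob (s \<inter> e) / prob s" if "e \<in> events" for e
      using pos that by (rule measure_uniform_measure)
    have "N.indep_set ?A ?B"
    proof (rule N.indep_setI)
      show "?A \<subseteq> N.events" "?B \<subseteq> N.events"
        using cylinders_past_events[OF n] cylinders_future_events[OF n] by simp_all
      fix e g assume e: "e \<in> ?A" and g: "g \<in> ?B"
      have ev: "e \<in> events" "g \<in> events"
        using e g cylinders_past_events[OF n] cylinders_future_events[OF n] by auto
      have "prob (s \<inter> (e \<inter> g)) * prob s = prob (s \<inter> e) * prob (s \<inter> g)"
      proof (cases "s \<inter> e = {} \<or> s \<inter> g = {}")
        case True
        then have "s \<inter> (e \<inter> g) = {}" by auto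
        with True show ?thesis by auto
      next
        case False
        with e g obtain m x k y where
          e': "e = cylinder M X {m..n} x" "m \<in> T" "m \<le> n" and
          g': "g = cylinder M X {n..k} y" "k \<in> T" "n \<le> k"
          by (auto simp: cylinders_def)
        have xy: "x n = i" "y n = i"
          using False e' g' by (auto simp: s_def cylinder_def)
        \<comment> \<open>The two paths agree at time \<open>n\<close>, so they can be glued to one path through \<open>i\<close>.\<close>
        define z where "z = (\<lambda>l. if l \<in> {m..n} then x l else y l)"
        have zx: "z l = x l" if "l \<in> {m..n}" for l
          using that by (simp add: z_def)
        have zy: "z l = y l" if "l \<in> {n..k}" for l
          using that xy by (cases "l = n") (auto simp: z_def)
        have zi: "z l = i" if "l \<in> {n..n}" for l
          using that zx[of n] e' xy by simp
        have z: "cylinder M X {m..n} z = e" "cylinder M X {n..k} z = g" "cylinder M X {n..n} z = s"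
          unfolding e'(1) g'(1) s by (rule cylinder_cong, fact zx zy zi)+
        have "e \<inter> g = cylinder M X ({m..n} \<union> {n..k}) z"
          unfolding e'(1) g'(1) z_def using xy by (intro cylinder_Int) auto
        also have "{m..n} \<union> {n..k} = {m..k}" using e' g' by auto
        finally have eg: "cylinder M X {m..k} z = e \<inter> g" ..
        have "s \<inter> (e \<inter> g) = e \<inter> g" "s \<inter> e = e" "s \<inter> g = g"
          using xy e' g' by (auto simp: s_def cylinder_def)
        then show ?thesis
          using cylinder_factorisation[of m n k z] e' g' n unfolding z eg by simp
      qed
      then show "N.prob (e \<inter> g) = N.prob e * N.prob g"
        using False ev by (simp add: N field_simps)
    qed
    moreover have "Int_stable ?A"
      by (rule Int_stable_cylinders) auto
    moreover have "Int_stable ?B"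
      by (rule Int_stable_cylinders) auto
    ultimately have "N.indep_set (sigma_sets (space ?N) ?A) (sigma_sets (space ?N) ?B)"
      by (rule N.indep_set_sigma_sets)
    moreover have "a \<in> sigma_sets (space ?N) ?A" "b \<in> sigma_sets (space ?N) ?B"
      using a b by (simp_all add: past_def future_def cylinders_subset)
    ultimately have "N.prob (a \<inter> b) = N.prob a * N.prob b"
      by (rule N.indep_setD)
    moreover have "a \<in> events" "b \<in> events"
      using a b sets_past[OF n] sets_future[OF n] by auto
    ultimately show ?thesis
      using False by (simp add: N field_simps)
  qed
qed

end

section \<open>The current of reactive trajectories\<close>

theorem theorem2p5:
  fixes M :: "'w measure" and T :: "int set" and X :: "int \<Rightarrow> 'w \<Rightarrow> 's::finite"
    and A B :: "'s set" and P :: "int \<Rightarrow> 's \<Rightarrow> 's \<Rightarrow> real" and qp qm :: "int \<Rightarrow> 's \<Rightarrow> real"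
    and n :: int and i j :: 's
  assumes "markov_chain M T X"
    and "A \<noteq> {}" and "B \<noteq> {}" and "A \<inter> B = {}" and "- (A \<union> B) \<noteq> {}"
    and "transition_probabilities M T X P"
    and "forward_committor M T X A B qp"
    and "backward_committor M T X A B qm"
    and "n \<in> T" and "n + 1 \<in> T"
  shows "reactive_current M T X A B n i j =
    qm n i * \<P>(w in M. X n w = i) * P n i j * qp (n + 1) j"
proof -
  interpret markov_chain M T X by fact
  note n = \<open>n \<in> T\<close> \<open>n + 1 \<in> T\<close>
  define I where "I = {w \<in> space M. X n w = i}"
  define J where "J = {w \<in> space M. X (n + 1) w = j}"
  define E where "E = {w \<in> space M. last_exit T X A n w > last_exit T X B n w}"
  define G where "G = {w \<in> space M. first_entrance T X B (n + 1) w < first_entrance T X A (n + 1) w}"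
  have E: "E \<in> sets (past M T X n)"
  proof -
    have "last_exit T X S n \<in> borel_measurable (past M T X n)" for S
      by (intro measurable_last_exit measurable_past)
    then have "{w \<in> space (past M T X n). last_exit T X B n w < last_exit T X A n w} \<in> sets (past M T X n)"
      by (intro borel_measurable_less)
    then show ?thesis by (simp add: E_def)
  qed
  have G: "G \<in> sets (future M T X l)" if "l \<le> n + 1" for l
  proof -
    have "first_entrance T X S (n + 1) \<in> borel_measurable (future M T X l)" for S
      using that by (intro measurable_first_entrance measurable_future) auto
    then have "{w \<in> space (future M T X l). first_entrance T X B (n + 1) w < first_entrance T X A (n + 1) w}
        \<in> sets (future M T X l)"
      by (intro borel_measurable_less)
    then show ?thesis by (simp add: G_def)
  qed
  have J: "J \<in> sets (future M T X n)"
    using measurable_sets[OF measurable_future[of "n + 1" T n X M], of "{j}"] n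
    by (simp add: J_def vimage_def Int_def conj_commute)
  have I: "I \<in> sets (past M T X (n + 1))"
    using measurable_sets[OF measurable_past[of n T "n + 1" X M], of "{i}"] n
    by (simp add: I_def vimage_def Int_def conj_commute)
  have ev: "I \<in> events" "J \<in> events" "E \<in> events" "G \<in> events"
    using I J E G[of n] sets_past n sets_future by auto
  \<comment> \<open>At present \<open>n\<close>, the step to \<open>j\<close> counts as future; at present \<open>n + 1\<close>, the state \<open>i\<close> counts
    as past.\<close>
  have split_n: "prob (I \<inter> (E \<inter> (J \<inter> G))) * prob I = prob (I \<inter> E) * prob (I \<inter> (J \<inter> G))"
    unfolding I_def using n(1) E J G by (intro past_future_factorisation) auto
  have split_Suc: "prob (J \<inter> (I \<inter> G)) * prob J = prob (J \<inter> I) * prob (J \<inter> G)"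
    unfolding J_def using n(2) I G by (intro past_future_factorisation) auto
  have current: "reactive_current M T X A B n i j = prob (I \<inter> (E \<inter> (J \<inter> G)))"
    unfolding reactive_current_def I_def J_def E_def G_def by (intro arg_cong[where f = prob]) auto
  have pI: "\<P>(w in M. X n w = i) = prob I" by (simp add: I_def)
  show ?thesis
  proof (cases "prob I = 0")
    case True
    have "prob (I \<inter> (E \<inter> (J \<inter> G))) \<le> prob I" using ev by (intro finite_measure_mono) auto
    with True have "prob (I \<inter> (E \<inter> (J \<inter> G))) = 0" by (auto intro!: antisym measure_nonneg)
    then show ?thesis unfolding current pI True by simp
  next
    case False
    then have posI: "prob I > 0" using measure_nonneg[of M I] by linarith
    have P: "P n i j = prob (J \<inter> I) / prob I"
      using \<open>transition_probabilities M T X P\<close> n posI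
      by (simp add: transition_probabilities_def cond_prob_def I_def J_def Int_def conj_ac)
    have qm: "qm n i = prob (I \<inter> E) / prob I"
      using \<open>backward_committor M T X A B qm\<close> n posI
      by (simp add: backward_committor_def cond_prob_def I_def E_def Int_def conj_ac)
    show ?thesis
    proof (cases "prob J = 0")
      case True
      have "prob (J \<inter> I) \<le> prob J" "prob (I \<inter> (E \<inter> (J \<inter> G))) \<le> prob J"
        using ev by (auto intro!: finite_measure_mono)
      with True have "prob (J \<inter> I) = 0" "prob (I \<inter> (E \<inter> (J \<inter> G))) = 0"
        by (auto intro!: antisym measure_nonneg)
      then show ?thesis unfolding current P by simp
    next
      case False
      then have posJ: "prob J > 0" using measure_nonneg[of M J] by linarith
      have qp: "qp (n + 1) j = prob (J \<inter> G) / prob J"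
        using \<open>forward_committor M T X A B qp\<close> n posJ
        by (simp add: forward_committor_def cond_prob_def J_def G_def Int_def conj_ac)
      have "prob (I \<inter> (E \<inter> (J \<inter> G))) = prob (I \<inter> E) * prob (I \<inter> (J \<inter> G)) / prob I"
        using split_n posI by (simp add: field_simps)
      also have "prob (I \<inter> (J \<inter> G)) = prob (J \<inter> I) * prob (J \<inter> G) / prob J"
        using split_Suc posJ by (simp add: field_simps Int_left_commute)
      finally show ?thesis
        unfolding current pI P qm qp using posI by (simp add: ac_simps)
    qed
  qed
qed

end
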